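(* Let $\alpha>-1$ and let $f:\mathbb{D}\to\mathbb{D}$ be an $\alpha$-harmonic function (i.e. $f=P_\alpha[f^\ast]$ for some $f^\ast\in L^\infty(\mathbb{T})$) with $f(0)=0$. Then for every $z\in\mathbb{D}$, with $r=|z|$, $$|f(z)|\le\frac{2(2+\alpha)\,r\,(1-r^2)^{1+\alpha}\,\Gamma\!\left(1+\frac{\alpha}{2}\right)^2}{\pi\,\Gamma(1+\alpha)\,(1+r^2)^{2+\frac{\alpha}{2}}}\;{}_3F_2\!\left(\begin{matrix}1,\ 1+\frac{\alpha}{4},\ \frac32+\frac{\alpha}{4}\\ \frac32,\ \frac32\end{matrix};\frac{4r^2}{(1+r^2)^2}\right).$$ For $\alpha=0$ the right-hand side equals $\frac{4}{\pi}\arctan r$.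
   Context: $\mathbb{D}$ is the open unit disk, $\mathbb{T}=\partial\mathbb{D}$. For $\alpha>-1$ let $c_\alpha=\frac{\Gamma(1+\alpha/2)^2}{\Gamma(1+\alpha)}$, $K_\alpha(z)=c_\alpha\frac{(1-|z|^2)^{\alpha+1}}{|1-z|^{\alpha+2}}$, and $P_\alpha[f^\ast](z)=\frac{1}{2\pi}\int_0^{2\pi}K_\alpha(ze^{-it})f^\ast(e^{it})\,dt$. ${}_3F_2$ denotes the generalized hypergeometric series ${}_3F_2\!\left(\begin{smallmatrix}a_1,a_2,a_3\\ b_1,b_2\end{smallmatrix};x\right)=\sum_{k\ge0}\frac{(a_1)_k(a_2)_k(a_3)_k}{(b_1)_k(b_2)_k\,k!}x^k$ with $(y)_k=\Gamma(y+k)/\Gamma(y)$. *)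

theory Defs
  imports "HOL-Analysis.Analysis"
begin

definition c_alpha :: "real \<Rightarrow> real" where
  "c_alpha \<alpha> = Gamma (1 + \<alpha>/2) ^ 2 / Gamma (1 + \<alpha>)"

definition K_alpha :: "real \<Rightarrow> complex \<Rightarrow> real" where
  "K_alpha \<alpha> z = c_alpha \<alpha> * (1 - (cmod z)\<^sup>2) powr (\<alpha> + 1) / (cmod (1 - z)) powr (\<alpha> + 2)"

definition P_alpha :: "real \<Rightarrow> (complex \<Rightarrow> complex) \<Rightarrow> complex \<Rightarrow> complex" where
  "P_alpha \<alpha> fstar z =
     complex_of_real (1 / (2 * pi)) *
     (LINT t:{0..2*pi}|lborel. complex_of_real (K_alpha \<alpha> (z * cis (- t))) * fstar (cis t))"

definition hyp3F2 :: "real \<Rightarrow> real \<Rightarrow> real \<Rightarrow> real \<Rightarrow> real \<Rightarrow> real \<Rightarrow> real" where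
  "hyp3F2 a1 a2 a3 b1 b2 x =
     (\<Sum>k. pochhammer a1 k * pochhammer a2 k * pochhammer a3 k
            / (pochhammer b1 k * pochhammer b2 k * fact k) * x ^ k)"

definition bound_rhs :: "real \<Rightarrow> real \<Rightarrow> real" where
  "bound_rhs \<alpha> r =
     2 * (2 + \<alpha>) * r * (1 - r\<^sup>2) powr (1 + \<alpha>) * Gamma (1 + \<alpha>/2) ^ 2
     / (pi * Gamma (1 + \<alpha>) * (1 + r\<^sup>2) powr (2 + \<alpha>/2))
     * hyp3F2 1 (1 + \<alpha>/4) (3/2 + \<alpha>/4) (3/2) (3/2) (4 * r\<^sup>2 / (1 + r\<^sup>2)\<^sup>2)"

end

theory Submission
  imports Defs
begin

text \<open>
  Since \<open>f 0 = 0\<close>, the boundary function \<open>f\<^sup>*\<close> has mean zero, so in the integral for \<open>f z\<close> the kernel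
  may be replaced by the kernel minus its value \<open>m\<close> at angular distance \<open>\<pi>/2\<close> from \<open>z\<close>. As
  \<open>\<bar>f\<^sup>*\<bar> \<le> 1\<close> almost everywhere, \<open>2\<pi> \<bar>f z\<bar> \<le> \<integral> \<bar>K - m\<bar>\<close>; the kernel decreases with the angular distance,
  so this is the integral of \<open>K\<close> over the near half circle minus that over the far one. Up to a
  factor it equals \<open>\<integral> (1 - s cos t)\<^sup>-\<^sup>p - (1 + s cos t)\<^sup>-\<^sup>p\<close> over \<open>[-\<pi>/2, \<pi>/2]\<close>, with
  \<open>s = 2r/(1 + r\<^sup>2)\<close> and \<open>p = 1 + \<alpha>/2\<close>, and expanding in powers of \<open>s\<close> gives the hypergeometric series.
  The bound on \<open>f\<^sup>*\<close> is used only tested against the continuous function \<open>K - m\<close>, where it follows from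
  \<open>\<bar>f\<bar> < 1\<close> because the kernel is an approximate identity.
\<close>

section \<open>Integrals of powers of the cosine and of $(1 - s\cos t)^{-p}$\<close>

text \<open>The Wallis integrals, over a half circle so that odd powers of the cosine
  survive.\<close>

definition cos_int :: "nat \<Rightarrow> real" where
  "cos_int n = integral {-(pi/2)..pi/2} (\<lambda>t. cos t ^ n)"

text \<open>Integrate the derivative of \<open>cos t ^ (n + 1) * sin t\<close>; the boundary values
  vanish because the cosine is 0 at both ends.\<close>

lemma cos_int_Suc_Suc: "cos_int (Suc (Suc n)) = real (n + 1) / real (n + 2) * cos_int n"
proof -
  have "((\<lambda>t. real (n + 2) * cos t ^ Suc (Suc n) - real (n + 1) * cos t ^ n) has_integral
          cos (pi/2) ^ (n + 1) * sin (pi/2) - cos (-(pi/2)) ^ (n + 1) * sin (-(pi/2))) {-(pi/2)..pi/2}"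
  proof (rule fundamental_theorem_of_calculus)
    fix t :: real
    have s: "sin t * sin t = 1 - cos t * cos t"
      using sin_squared_eq[of t] by (simp add: power2_eq_square)
    have "((\<lambda>t. cos t ^ (n + 1) * sin t) has_real_derivative
            cos t ^ (n + 1) * cos t - real (n + 1) * cos t ^ n * (sin t * sin t)) (at t)"
      using DERIV_mult[OF DERIV_power_Suc[OF DERIV_cos, of n] DERIV_sin, of t] by (simp add: algebra_simps)
    also have "cos t ^ (n + 1) * cos t - real (n + 1) * cos t ^ n * (sin t * sin t)
       = real (n + 2) * cos t ^ Suc (Suc n) - real (n + 1) * cos t ^ n"
      unfolding s by (simp add: algebra_simps)
    finally show "((\<lambda>t. cos t ^ (n + 1) * sin t) has_vector_derivative
            real (n + 2) * cos t ^ Suc (Suc n) - real (n + 1) * cos t ^ n) (at t within {-(pi/2)..pi/2})"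
      using has_real_derivative_iff_has_vector_derivative has_vector_derivative_at_within by blast
  qed simp
  moreover have "((\<lambda>t. real (n + 2) * cos t ^ Suc (Suc n) - real (n + 1) * cos t ^ n) has_integral
      real (n + 2) * cos_int (Suc (Suc n)) - real (n + 1) * cos_int n) {-(pi/2)..pi/2}"
    unfolding cos_int_def
    by (intro has_integral_diff has_integral_mult_right integrable_integral integrable_continuous_interval
        continuous_intros)
  ultimately have "real (n + 2) * cos_int (Suc (Suc n)) - real (n + 1) * cos_int n =
      cos (pi/2) ^ (n + 1) * sin (pi/2) - cos (-(pi/2)) ^ (n + 1) * sin (-(pi/2))"
    using has_integral_unique by blast
  then have "real (n + 2) * cos_int (Suc (Suc n)) = real (n + 1) * cos_int n"
    by simp
  then show ?thesis by (simp add: field_simps del: of_nat_add)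
qed

lemma cos_int_0: "cos_int 0 = pi"
  by (simp add: cos_int_def)

lemma cos_int_1: "cos_int (Suc 0) = 2"
proof -
  have "(cos has_integral sin (pi/2) - sin (-(pi/2))) {-(pi/2)..pi/2}"
    by (rule fundamental_theorem_of_calculus)
      (auto intro!: derivative_eq_intros simp flip: has_real_derivative_iff_has_vector_derivative)
  then show ?thesis by (simp add: cos_int_def integral_unique)
qed

text \<open>The recursion factor is (k + 1/2)/(k + 1) here and (k + 1)/(k + 3/2) for odd exponents,
  that is, one new factor in each Pochhammer symbol.\<close>

lemma cos_int_even: "cos_int (2 * k) = pi * pochhammer (1/2) k / fact k"
proof (induction k)
  case (Suc k)
  have "cos_int (2 * Suc k) = real (2 * k + 1) / real (2 * k + 2) * cos_int (2 * k)"
    using cos_int_Suc_Suc[of "2 * k"] by simp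
  then show ?case unfolding Suc.IH by (simp add: pochhammer_Suc field_simps)
qed (simp add: cos_int_0)

lemma cos_int_odd: "cos_int (2 * k + 1) = 2 * fact k / pochhammer (3/2) k"
proof (induction k)
  case (Suc k)
  have p: "pochhammer (3/2) k > (0::real)" by (rule pochhammer_pos) simp
  have "cos_int (2 * Suc k + 1) = real (2 * k + 2) / real (2 * k + 3) * cos_int (2 * k + 1)"
    using cos_int_Suc_Suc[of "2 * k + 1"] by simp
  then show ?case unfolding Suc.IH using p by (simp add: pochhammer_Suc divide_simps) (simp add: algebra_simps)
qed (simp add: cos_int_1)

section \<open>Power series of the half-circle integrals\<close>

lemma binomial_series_neg_powr:
  fixes x p :: real
  assumes "\<bar>x\<bar> < 1"
  shows "(\<lambda>n. pochhammer p n / fact n * x ^ n) sums (1 - x) powr (- p)"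
proof -
  have "(\<lambda>n. (- p gchoose n) * (- x) ^ n) sums (1 + - x) powr (- p)"
    by (rule gen_binomial_real) (use assms in simp)
  moreover have "(- p gchoose n) * (- x) ^ n = pochhammer p n / fact n * x ^ n" for n
    by (simp add: gbinomial_pochhammer power_minus[of x] flip: power_add mult_2)
  ultimately show ?thesis by simp
qed

lemma one_minus_mult_cos_pos:
  fixes s t :: real
  assumes "\<bar>s\<bar> < 1"
  shows "0 < 1 - s * cos t"
proof -
  have "\<bar>s * cos t\<bar> \<le> \<bar>s\<bar>"
    using abs_cos_le_one[of t] by (simp add: abs_mult mult_left_le)
  then show ?thesis using assms by linarith
qed

text \<open>For s \<ge> 0 this belongs to the half circle around the peak of the kernel;
  \<open>half_int p (- s)\<close> belongs to the opposite one.\<close>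

definition half_int :: "real \<Rightarrow> real \<Rightarrow> real" where
  "half_int p s = integral {-(pi/2)..pi/2} (\<lambda>t. (1 - s * cos t) powr (- p))"

lemma has_integral_half_int:
  assumes "\<bar>s\<bar> < 1"
  shows "((\<lambda>t. (1 - s * cos t) powr (- p)) has_integral half_int p s) {-(pi/2)..pi/2}"
proof -
  have "1 - s * cos t \<noteq> 0" for t
    using one_minus_mult_cos_pos[OF assms, of t] by simp
  then show ?thesis
    unfolding half_int_def
    by (intro integrable_integral integrable_continuous_interval continuous_intros) auto
qed

text \<open>Termwise integration of the binomial series in \<open>s * cos t\<close>, which is
  dominated uniformly in t by the same series at \<open>\<bar>s\<bar>\<close>.\<close>

lemma half_int_sums:
  assumes s: "\<bar>s\<bar> < 1" and p: "0 < p"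
  shows "(\<lambda>n. pochhammer p n / fact n * cos_int n * s ^ n) sums half_int p s"
proof -
  let ?a = "\<lambda>n. pochhammer p n / fact n :: real"
  let ?f = "\<lambda>n t. ?a n * (s * cos t) ^ n"
  have a: "0 \<le> ?a n" for n by (simp add: p pochhammer_nonneg)
  have sc: "\<bar>s * cos t\<bar> \<le> \<bar>s\<bar>" for t
    using abs_cos_le_one[of t] by (simp add: abs_mult mult_left_le)
  have "uniform_limit {-(pi/2)..pi/2} (\<lambda>n t. \<Sum>i<n. ?f i t) (\<lambda>t. \<Sum>i. ?f i t) sequentially"
  proof (rule Weierstrass_m_test)
    show "summable (\<lambda>n. ?a n * \<bar>s\<bar> ^ n)"
      using binomial_series_neg_powr[of "\<bar>s\<bar>" p] s by (simp add: sums_iff)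
    fix n t
    show "norm (?f n t) \<le> ?a n * \<bar>s\<bar> ^ n"
      using mult_left_mono[OF power_mono[OF sc[of t], of n] a[of n]] a[of n] p
      by (simp add: abs_mult[of "pochhammer p n"] power_abs pochhammer_nonneg)
  qed
  also have "(\<lambda>t. \<Sum>i. ?f i t) = (\<lambda>t. (1 - s * cos t) powr (- p))"
  proof
    fix t
    show "(\<Sum>i. ?f i t) = (1 - s * cos t) powr (- p)"
      using binomial_series_neg_powr[of "s * cos t" p] sc[of t] s by (simp add: sums_iff)
  qed
  finally obtain I J where IJ: "\<And>n. ((\<lambda>t. \<Sum>i<n. ?f i t) has_integral I n) {-(pi/2)..pi/2}"
    "((\<lambda>t. (1 - s * cos t) powr (- p)) has_integral J) {-(pi/2)..pi/2}" "I \<longlonglongrightarrow> J"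
    by (rule uniform_limit_integral) (auto intro!: continuous_intros)
  have "I = (\<lambda>n. \<Sum>i<n. ?a i * cos_int i * s ^ i)"
  proof (rule ext)
    fix n
    have "((\<lambda>t. \<Sum>i<n. ?a i * s ^ i * cos t ^ i) has_integral (\<Sum>i<n. ?a i * s ^ i * cos_int i)) {-(pi/2)..pi/2}"
      unfolding cos_int_def
      by (intro has_integral_sum has_integral_mult_right integrable_integral
          integrable_continuous_interval continuous_intros) auto
    then show "I n = (\<Sum>i<n. ?a i * cos_int i * s ^ i)"
      using has_integral_unique[OF IJ(1)[of n]] by (simp add: power_mult_distrib mult_ac)
  qed
  moreover have "J = half_int p s"
    using IJ(2) has_integral_half_int[OF s] has_integral_unique by blast
  ultimately show ?thesis using IJ(3) by (simp add: sums_def)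
qed

lemma sums_even_part:
  fixes f :: "nat \<Rightarrow> 'a::real_normed_vector"
  assumes "f sums a" "\<And>n. odd n \<Longrightarrow> f n = 0"
  shows "(\<lambda>k. f (2 * k)) sums a"
proof (subst sums_mono_reindex)
  show "strict_mono ((*) (2::nat))" by (simp add: strict_mono_def)
  show "f n = 0" if "n \<notin> range ((*) 2)" for n using assms(2) that by (metis evenE rangeI)
qed fact

lemma sums_odd_part:
  fixes f :: "nat \<Rightarrow> 'a::real_normed_vector"
  assumes "f sums a" "\<And>n. even n \<Longrightarrow> f n = 0"
  shows "(\<lambda>k. f (2 * k + 1)) sums a"
proof (subst sums_mono_reindex[where g = "\<lambda>k. 2 * k + 1"])
  show "strict_mono (\<lambda>k::nat. 2 * k + 1)" by (simp add: strict_mono_def)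
  show "f n = 0" if "n \<notin> range (\<lambda>k. 2 * k + 1)" for n using assms(2) that by (metis oddE rangeI)
qed fact

text \<open>Even powers cancel and odd ones double. In the factor \<open>4 * p * s\<close> one 2 is
  this doubling, the other comes from \<open>cos_int_odd\<close>, and p is the first factor of the
  Pochhammer symbol of odd length.\<close>

lemma half_int_odd_sums:
  assumes s: "\<bar>s\<bar> < 1" and p: "0 < p"
  shows "(\<lambda>k. 4 * p * s * (pochhammer 1 k * pochhammer ((p+1)/2) k * pochhammer ((p+2)/2) k
            / (pochhammer (3/2) k * pochhammer (3/2) k * fact k) * (s\<^sup>2) ^ k)) sums
         (half_int p s - half_int p (- s))"
proof -
  let ?f = "\<lambda>n. pochhammer p n / fact n * cos_int n * s ^ n - pochhammer p n / fact n * cos_int n * (- s) ^ n"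
  have "?f sums (half_int p s - half_int p (- s))"
    using s by (intro sums_diff half_int_sums p) auto
  then have "(\<lambda>k. ?f (2 * k + 1)) sums (half_int p s - half_int p (- s))"
    by (rule sums_odd_part) (auto simp: uminus_power_if)
  moreover have "?f (2 * k + 1) = 4 * p * s * (pochhammer 1 k * pochhammer ((p+1)/2) k * pochhammer ((p+2)/2) k
            / (pochhammer (3/2) k * pochhammer (3/2) k * fact k) * (s\<^sup>2) ^ k)" for k
  proof -
    \<comment> \<open>Split off the first factor; the remaining product of even length separates
      into its alternate factors. The power of 4 cancels against the one in
      \<open>2\<close>.\<close>
    have 1: "pochhammer p (2 * k + 1) = p * (4 ^ k * pochhammer ((p+1)/2) k * pochhammer ((p+2)/2) k)"
      using pochhammer_double[of "(p+1)/2" k]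
      by (simp add: pochhammer_rec power_mult add_divide_distrib add.commute add.left_commute)
    have 2: "fact (2 * k + 1) = (4 ^ k * pochhammer (3/2) k * fact k :: real)"
      using pochhammer_double[of "1::real" k] pochhammer_rec[of "1::real" "2*k"]
      by (simp add: pochhammer_fact power_mult pochhammer_rec)
    have 3: "s ^ (2 * k + 1) = s * (s\<^sup>2) ^ k" "(- s) ^ (2 * k + 1) = - (s * (s\<^sup>2) ^ k)"
      by (simp_all add: power_mult)
    show ?thesis unfolding 1 2 3 cos_int_odd
      by (simp add: field_simps flip: pochhammer_fact)
  qed
  ultimately show ?thesis by simp
qed

text \<open>Serves for the total mass of the kernel. The symbol \<open>pochhammer (1/2) k\<close>
  from \<open>cos_int_even\<close> cancels against the factorial, leaving a 2F1 with parameters p/2,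
  (p+1)/2 and 1.\<close>

lemma half_int_even_sums:
  assumes s: "\<bar>s\<bar> < 1" and p: "0 < p"
  shows "(\<lambda>k. 2 * pi * (pochhammer (p/2) k * pochhammer ((p+1)/2) k
            / (fact k * fact k) * (s\<^sup>2) ^ k)) sums
         (half_int p s + half_int p (- s))"
proof -
  let ?f = "\<lambda>n. pochhammer p n / fact n * cos_int n * s ^ n + pochhammer p n / fact n * cos_int n * (- s) ^ n"
  have "?f sums (half_int p s + half_int p (- s))"
    using s by (intro sums_add half_int_sums p) auto
  then have "(\<lambda>k. ?f (2 * k)) sums (half_int p s + half_int p (- s))"
    by (rule sums_even_part) (auto simp: uminus_power_if)
  moreover have "?f (2 * k) = 2 * pi * (pochhammer (p/2) k * pochhammer ((p+1)/2) k
            / (fact k * fact k) * (s\<^sup>2) ^ k)" for k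
  proof -
    have 1: "pochhammer p (2 * k) = 4 ^ k * pochhammer (p/2) k * pochhammer ((p+1)/2) k"
      using pochhammer_double[of "p/2" k] by (simp add: power_mult add_divide_distrib)
    have 2: "fact (2 * k) = (4 ^ k * pochhammer (1/2) k * fact k :: real)"
      using fact_double[of k, where 'a = real] by (simp add: power_mult)
    have 3: "s ^ (2 * k) = (s\<^sup>2) ^ k" "(- s) ^ (2 * k) = (s\<^sup>2) ^ k"
      by (simp_all add: power_mult)
    have "pochhammer (1/2) k > (0::real)" by (rule pochhammer_pos) simp
    then show ?thesis unfolding 1 2 3 cos_int_even
      by (simp add: field_simps)
  qed
  ultimately show ?thesis by simp
qed

lemma half_int_odd_hyp:
  assumes s: "\<bar>s\<bar> < 1" and p: "0 < p"
  shows "half_int p s - half_int p (- s) = 4 * p * s * hyp3F2 1 ((p+1)/2) ((p+2)/2) (3/2) (3/2) (s\<^sup>2)"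
\<comment> \<open>The series is divided by \<open>4 * p * s\<close>, so s = 0 is treated apart;
  there both sides are 0.\<close>
proof (cases "s = 0")
  case False
  then show ?thesis
    using half_int_odd_sums[OF s p] sums_mult_D[OF half_int_odd_sums[OF s p]] p
    unfolding hyp3F2_def by (simp add: sums_iff suminf_mult)
qed (simp)

text \<open>For exponent 1 the difference of the integrands is 2 s cos t / (q^2 + s^2 sin^2 t) with
  q^2 = 1 - s^2, and the substitution u = s sin t leads to an arctangent.\<close>

lemma half_int_one_odd:
  assumes s: "\<bar>s\<bar> < 1"
  shows "half_int 1 s - half_int 1 (- s) = 4 / sqrt (1 - s\<^sup>2) * arctan (s / sqrt (1 - s\<^sup>2))"
proof -
  define q where "q = sqrt (1 - s\<^sup>2)"
  have s2: "s\<^sup>2 < 1" using s by (simp add: abs_square_less_1)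
  have q: "q > 0" "q\<^sup>2 = 1 - s\<^sup>2" using s2 by (auto simp: q_def)
  have "((\<lambda>t. (1 - s * cos t) powr (- 1) - (1 - (- s) * cos t) powr (- 1)) has_integral
     2 / q * arctan (s * sin (pi/2) / q) - 2 / q * arctan (s * sin (-(pi/2)) / q)) {-(pi/2)..pi/2}"
  proof (rule fundamental_theorem_of_calculus)
    fix t :: real
    have c: "1 - s * cos t > 0" "1 + s * cos t > 0"
      using one_minus_mult_cos_pos[OF s, of t] one_minus_mult_cos_pos[of "-s" t] s by auto
    have e: "q\<^sup>2 + (s * sin t)\<^sup>2 = (1 - s * cos t) * (1 + s * cos t)"
      unfolding q(2) power_mult_distrib sin_squared_eq by (simp add: algebra_simps power2_eq_square)
    have "((\<lambda>t. 2 / q * arctan (s * sin t / q)) has_real_derivative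
      2 / q * (s * cos t / q / (1 + (s * sin t / q)\<^sup>2))) (at t)"
      using q(1) by (auto intro!: derivative_eq_intros simp: divide_inverse)
    also have "2 / q * (s * cos t / q / (1 + (s * sin t / q)\<^sup>2)) = 2 * s * cos t / (q\<^sup>2 + (s * sin t)\<^sup>2)"
      using q(1) by (simp add: divide_simps power2_eq_square)
    also have "\<dots> = 1 / (1 - s * cos t) - 1 / (1 + s * cos t)"
      unfolding e using c by (simp add: field_simps)
    also have "\<dots> = (1 - s * cos t) powr (- 1) - (1 - (- s) * cos t) powr (- 1)"
      using c by (simp add: powr_minus_divide)
    finally show "((\<lambda>t. 2 / q * arctan (s * sin t / q)) has_vector_derivative
       (1 - s * cos t) powr (- 1) - (1 - (- s) * cos t) powr (- 1)) (at t within {-(pi/2)..pi/2})"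
      using has_real_derivative_iff_has_vector_derivative has_vector_derivative_at_within by blast
  qed simp
  moreover have "((\<lambda>t. (1 - s * cos t) powr (- 1) - (1 - (- s) * cos t) powr (- 1)) has_integral
     half_int 1 s - half_int 1 (- s)) {-(pi/2)..pi/2}"
    by (intro has_integral_diff has_integral_half_int) (use s in auto)
  ultimately have "half_int 1 s - half_int 1 (- s) =
     2 / q * arctan (s * sin (pi/2) / q) - 2 / q * arctan (s * sin (-(pi/2)) / q)"
    using has_integral_unique by blast
  then show ?thesis by (simp add: q_def arctan_minus)
qed

section \<open>The kernel on circles and its total mass\<close>

text \<open>For a \<le> b, cut the interval from a to b + T once at b and once at a + T; the
  leftover pieces agree by periodicity.\<close>

lemma integral_periodic_eq:
  fixes \<phi> :: "real \<Rightarrow> real"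
  assumes c: "continuous_on UNIV \<phi>" and per: "\<And>x. \<phi> (x + T) = \<phi> x" and T: "0 \<le> T"
  shows "integral {a..a + T} \<phi> = integral {b..b + T} \<phi>"
proof -
  have i: "\<phi> integrable_on {u..v}" for u v
    using c by (intro integrable_continuous_interval) (rule continuous_on_subset, auto)
  have *: "integral {a..a + T} \<phi> = integral {b..b + T} \<phi>" if "a \<le> b" for a b
  proof -
    have "integral {a..b} \<phi> + integral {b..b + T} \<phi> = integral {a..b + T} \<phi>"
      using that T i by (intro Henstock_Kurzweil_Integration.integral_combine) auto
    moreover have "integral {a..a + T} \<phi> + integral {a + T..b + T} \<phi> = integral {a..b + T} \<phi>"
      using that T i by (intro Henstock_Kurzweil_Integration.integral_combine) auto
    moreover have "integral {a..b} \<phi> = integral {a + T..b + T} \<phi>"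
      using integral_shift_real_ivl[of "a + T" T "b + T" \<phi>] per by simp
    ultimately show ?thesis by linarith
  qed
  show ?thesis using *[of a b] *[of b a] by linarith
qed

text \<open>Periodicity removes the rotation by \<theta>, and a shift by pi folds the half circle of
  negative cosine onto the other.\<close>

lemma integral_cos_shift:
  fixes \<Phi> :: "real \<Rightarrow> real"
  assumes "continuous_on {-1..1} \<Phi>"
  shows "integral {0..2*pi} (\<lambda>t. \<Phi> (cos (t - \<theta>))) =
    integral {-(pi/2)..pi/2} (\<lambda>t. \<Phi> (cos t) + \<Phi> (- cos t))"
proof -
  have c: "continuous_on A (\<lambda>t. \<Phi> (cos t))" for A
    by (rule continuous_on_compose2[OF assms]) (auto intro!: continuous_intros)
  have c': "continuous_on A (\<lambda>t. \<Phi> (- cos t))" for A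
    by (rule continuous_on_compose2[OF assms]) (auto intro!: continuous_intros)
  have "integral {0..2*pi} (\<lambda>t. \<Phi> (cos (t - \<theta>))) = integral {-\<theta>..-\<theta> + 2 * pi} (\<lambda>t. \<Phi> (cos t))"
    using integral_shift_real_ivl[of 0 \<theta> "2 * pi" "\<lambda>t. \<Phi> (cos (t - \<theta>))"] by (simp add: add.commute)
  also have "\<dots> = integral {-(pi/2)..-(pi/2) + 2 * pi} (\<lambda>t. \<Phi> (cos t))"
    by (rule integral_periodic_eq) (auto intro: c)
  also have "\<dots> = integral {-(pi/2)..pi/2} (\<lambda>t. \<Phi> (cos t)) + integral {pi/2..-(pi/2) + 2 * pi} (\<lambda>t. \<Phi> (cos t))"
    by (rule Henstock_Kurzweil_Integration.integral_combine[symmetric])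
      (auto intro!: integrable_continuous_interval c)
  also have "integral {pi/2..-(pi/2) + 2 * pi} (\<lambda>t. \<Phi> (cos t)) = integral {-(pi/2)..pi/2} (\<lambda>t. \<Phi> (- cos t))"
    using integral_shift_real_ivl[of "pi/2" pi "-(pi/2) + 2 * pi" "\<lambda>t. \<Phi> (cos t)"] by simp
  also have "integral {-(pi/2)..pi/2} (\<lambda>t. \<Phi> (cos t)) + integral {-(pi/2)..pi/2} (\<lambda>t. \<Phi> (- cos t)) =
     integral {-(pi/2)..pi/2} (\<lambda>t. \<Phi> (cos t) + \<Phi> (- cos t))"
    by (rule integral_add[symmetric]) (auto intro!: integrable_continuous_interval c c')
  finally show ?thesis .
qed

section \<open>The kernel in polar coordinates\<close>

lemma c_alpha_pos: "-1 < \<alpha> \<Longrightarrow> 0 < c_alpha \<alpha>"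
  unfolding c_alpha_def by (auto intro!: divide_pos_pos zero_less_power Gamma_real_pos)

text \<open>
  On the circle of radius \<open>\<rho>\<close> we have \<open>\<bar>1 - \<rho> e\<^sup>i\<^sup>t\<bar>\<^sup>2 = (1 + \<rho>\<^sup>2)(1 - s cos t)\<close> with \<open>s = K_ecc \<rho>\<close>;
  \<open>K_scale \<alpha> \<rho>\<close> is thus the value of the kernel at \<open>t = \<plusminus>\<pi>/2\<close>, which is its median.
\<close>

definition K_scale :: "real \<Rightarrow> real \<Rightarrow> real" where
  "K_scale \<alpha> \<rho> = c_alpha \<alpha> * (1 - \<rho>\<^sup>2) powr (\<alpha> + 1) * (1 + \<rho>\<^sup>2) powr (- (1 + \<alpha>/2))"

definition K_ecc :: "real \<Rightarrow> real" where
  "K_ecc \<rho> = 2 * \<rho> / (1 + \<rho>\<^sup>2)"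

lemma K_ecc_bounds:
  assumes "0 \<le> \<rho>" "\<rho> < 1"
  shows "0 \<le> K_ecc \<rho>" "K_ecc \<rho> < 1"
proof -
  show "0 \<le> K_ecc \<rho>" unfolding K_ecc_def using assms by (intro divide_nonneg_pos add_pos_nonneg) auto
  have "0 < (1 - \<rho>)\<^sup>2" using assms by simp
  then have "2 * \<rho> < 1 + \<rho>\<^sup>2" by (simp add: power2_diff)
  moreover have "0 < 1 + \<rho>\<^sup>2" by (simp add: add_pos_nonneg)
  ultimately show "K_ecc \<rho> < 1" unfolding K_ecc_def by simp
qed

text \<open>From (1 + \<rho>^2)^2 - 4 \<rho>^2 = (1 - \<rho>^2)^2. Used in the mass estimate and in
  the case \<alpha> = 0.\<close>

lemma one_minus_K_ecc_sq:
  "1 - (K_ecc \<rho>)\<^sup>2 = ((1 - \<rho>\<^sup>2) / (1 + \<rho>\<^sup>2))\<^sup>2"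
proof -
  have "1 + \<rho>\<^sup>2 > 0" by (simp add: add_pos_nonneg)
  then show ?thesis unfolding K_ecc_def power_divide
    by (simp add: field_simps) (simp add: algebra_simps power2_eq_square)
qed

lemma K_scale_pos: "-1 < \<alpha> \<Longrightarrow> 0 \<le> \<rho> \<Longrightarrow> \<rho> < 1 \<Longrightarrow> 0 < K_scale \<alpha> \<rho>"
  using power_strict_mono[of \<rho> 1 2]
  by (simp add: K_scale_def c_alpha_pos add_nonneg_eq_0_iff)

lemma norm_one_minus_cis_sq: "(cmod (1 - of_real \<rho> * cis t))\<^sup>2 = 1 + \<rho>\<^sup>2 - 2 * \<rho> * cos t"
proof -
  have "(cmod (1 - of_real \<rho> * cis t))\<^sup>2 = (1 - \<rho> * cos t)\<^sup>2 + \<rho>\<^sup>2 * (sin t)\<^sup>2"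
    by (simp add: cmod_power2 power_mult_distrib)
  then show ?thesis
    unfolding sin_squared_eq by (simp add: power2_eq_square algebra_simps)
qed

lemma K_alpha_polar:
  assumes "0 \<le> \<rho>" "\<rho> < 1"
  shows "K_alpha \<alpha> (of_real \<rho> * cis t) = K_scale \<alpha> \<rho> * (1 - K_ecc \<rho> * cos t) powr (- (1 + \<alpha>/2))"
proof -
  have p: "0 < 1 - K_ecc \<rho> * cos t" "0 < 1 + \<rho>\<^sup>2"
    using one_minus_mult_cos_pos[of "K_ecc \<rho>" t] K_ecc_bounds[OF assms] by (auto simp: add_pos_nonneg)
  have e: "(cmod (1 - of_real \<rho> * cis t))\<^sup>2 = (1 + \<rho>\<^sup>2) * (1 - K_ecc \<rho> * cos t)"
    unfolding norm_one_minus_cis_sq K_ecc_def using p(2) by (simp add: field_simps)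
  have n: "0 < cmod (1 - of_real \<rho> * cis t)"
    using e p by (metis mult_pos_pos norm_ge_zero not_less_iff_gr_or_eq order.order_iff_strict power_zero_numeral)
  \<comment> \<open>Halving the exponent brings in the squared modulus, which is affine in cos
    t.\<close>
  have "cmod (1 - of_real \<rho> * cis t) powr (\<alpha> + 2) = ((cmod (1 - of_real \<rho> * cis t))\<^sup>2) powr (1 + \<alpha>/2)"
    using n by (simp add: powr_powr flip: powr_numeral) (simp add: add.commute)
  also have "\<dots> = (1 + \<rho>\<^sup>2) powr (1 + \<alpha>/2) * (1 - K_ecc \<rho> * cos t) powr (1 + \<alpha>/2)"
    unfolding e using p by (simp add: powr_mult)
  finally show ?thesis
    using assms unfolding K_alpha_def K_scale_def powr_minus_divide
    by (simp add: norm_mult)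
qed

lemma continuous_on_kernel_profile:
  fixes s p :: real
  assumes "\<bar>s\<bar> < 1"
  shows "continuous_on {-1..1} (\<lambda>x. (1 - s * x) powr (- p))"
proof -
  have "1 - s * x \<noteq> 0" if "x \<in> {-1..1}" for x
    using one_minus_mult_cos_pos[OF assms, of "arccos x"] that by simp
  then show ?thesis by (intro continuous_intros) auto
qed

text \<open>This mass is 2 pi \<open>c_alpha \<alpha>\<close> at \<rho> = 0, hence not 2 pi in
  general; its behaviour as \<rho> tends to 1 has to be studied.\<close>

lemma integral_K_alpha:
  assumes "0 \<le> \<rho>" "\<rho> < 1"
  shows "integral {0..2*pi} (\<lambda>t. K_alpha \<alpha> (of_real \<rho> * cis (t - \<theta>))) =
    K_scale \<alpha> \<rho> * (half_int (1 + \<alpha>/2) (K_ecc \<rho>) + half_int (1 + \<alpha>/2) (- K_ecc \<rho>))"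
proof -
  have s: "\<bar>K_ecc \<rho>\<bar> < 1" using K_ecc_bounds[OF assms] by simp
  have "integral {0..2*pi} (\<lambda>t. (1 - K_ecc \<rho> * cos (t - \<theta>)) powr (- p)) =
     half_int p (K_ecc \<rho>) + half_int p (- K_ecc \<rho>)" for p
    using integral_cos_shift[OF continuous_on_kernel_profile[OF s, of p], where \<theta> = \<theta>] has_integral_add[OF has_integral_half_int[OF s, of p] has_integral_half_int[of "- K_ecc \<rho>" p]] s
    by (simp add: integral_unique)
  from this[of "1 + \<alpha>/2"] show ?thesis unfolding K_alpha_polar[OF assms] by simp
qed

section \<open>Abelian comparison of power series and the limiting mass\<close>

text \<open>For l < L all but finitely many terms satisfy \<open>l * b k \<le> a k\<close>; the
  others contribute a bounded amount, which the factor w, tending to 0, removes.\<close>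

lemma abelian_lower_bound:
  fixes a b :: "nat \<Rightarrow> real" and x w :: "'a \<Rightarrow> real"
  assumes ratio: "(\<lambda>k. a k / b k) \<longlonglongrightarrow> L" and b: "\<And>k. 0 < b k"
    and A: "\<And>u. 0 \<le> u \<Longrightarrow> u < 1 \<Longrightarrow> (\<lambda>k. a k * u ^ k) sums A u"
    and B: "\<And>u. 0 \<le> u \<Longrightarrow> u < 1 \<Longrightarrow> (\<lambda>k. b k * u ^ k) sums B u"
    and x: "eventually (\<lambda>i. 0 \<le> x i \<and> x i < 1) F"
    and w: "eventually (\<lambda>i. 0 \<le> w i) F" "(w \<longlongrightarrow> 0) F"
    and D: "((\<lambda>i. w i * B (x i)) \<longlongrightarrow> D) F" "0 < D"
    and y: "y < L * D"
  shows "eventually (\<lambda>i. y < w i * A (x i)) F"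
proof -
  \<comment> \<open>Strictly below the limiting ratio, yet large enough for y < l D.\<close>
  obtain l where l: "y / D < l" "l < L"
    using dense[of "y / D" L] y D(2) by (auto simp: field_simps)
  obtain N where N: "\<And>k. N \<le> k \<Longrightarrow> l < a k / b k"
    using order_tendstoD(1)[OF ratio l(2)] by (auto simp: eventually_sequentially)
  define C where "C = (\<Sum>k<N. \<bar>a k - l * b k\<bar>)"
  have lower: "l * B u - C \<le> A u" if u: "0 \<le> u" "u < 1" for u
  proof -
    let ?d = "\<lambda>k. a k * u ^ k - l * (b k * u ^ k)"
    have d: "?d sums (A u - l * B u)"
      by (intro sums_diff sums_mult A B u)
    have "- C \<le> (\<Sum>k<N. ?d k)"
    proof -
      have "\<bar>\<Sum>k<N. ?d k\<bar> \<le> C"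
        unfolding C_def
      proof (rule order_trans[OF sum_abs sum_mono])
        fix k
        have "?d k = (a k - l * b k) * u ^ k" by (simp add: algebra_simps)
        then have "\<bar>?d k\<bar> = \<bar>a k - l * b k\<bar> * u ^ k" using u by (simp add: abs_mult)
        also have "\<dots> \<le> \<bar>a k - l * b k\<bar>"
          using u by (simp add: mult_left_le power_le_one)
        finally show "\<bar>?d k\<bar> \<le> \<bar>a k - l * b k\<bar>" .
      qed
      then show ?thesis by linarith
    qed
    also have "(\<Sum>k<N. ?d k) \<le> (\<Sum>k. ?d k)"
    proof (rule sum_le_suminf)
      show "summable ?d" using d by (simp add: sums_iff)
      fix k assume "k \<in> - {..<N}"
      then have "l * b k \<le> a k" using N[of k] b[of k] by (simp add: field_simps)
      then have "l * b k * u ^ k \<le> a k * u ^ k" using u by (intro mult_right_mono) auto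
      then show "0 \<le> ?d k" by (simp add: mult.assoc)
    qed simp
    also have "\<dots> = A u - l * B u" using d by (simp add: sums_iff)
    finally show ?thesis by simp
  qed
  have "((\<lambda>i. l * (w i * B (x i)) - C * w i) \<longlongrightarrow> l * D - C * 0) F"
    by (intro tendsto_intros D w)
  moreover have "y < l * D - C * 0" using l(1) D(2) by (simp add: field_simps)
  ultimately have "eventually (\<lambda>i. y < l * (w i * B (x i)) - C * w i) F"
    by (rule order_tendstoD)
  then show ?thesis using x w(1)
  proof eventually_elim
    case (elim i)
    then have "w i * (l * B (x i) - C) \<le> w i * A (x i)"
      using lower by (intro mult_left_mono) auto
    then show ?case using elim(1) by (simp add: algebra_simps)
  qed
qed

text \<open>Quotient of the Gamma approximations (k-1)! k^x / (x)_k at the four parameters; the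
  condition a + b = c + d cancels the powers of k.\<close>

lemma pochhammer_ratio_tendsto:
  fixes a b c d :: real
  assumes "0 < a" "0 < b" "0 < c" "0 < d" "a + b = c + d"
  shows "(\<lambda>k. pochhammer a k * pochhammer b k / (pochhammer c k * pochhammer d k))
           \<longlonglongrightarrow> Gamma c * Gamma d / (Gamma a * Gamma b)"
proof -
  have "Gamma a \<noteq> 0" "Gamma b \<noteq> 0"
    using assms Gamma_real_pos less_irrefl by metis+
  then have "(\<lambda>k. Gamma_series' c k * Gamma_series' d k / (Gamma_series' a k * Gamma_series' b k))
           \<longlonglongrightarrow> Gamma c * Gamma d / (Gamma a * Gamma b)"
    by (intro tendsto_intros Gamma_series'_LIMSEQ) auto
  moreover have "Gamma_series' c k * Gamma_series' d k / (Gamma_series' a k * Gamma_series' b k) =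
     pochhammer a k * pochhammer b k / (pochhammer c k * pochhammer d k)" for k
  proof -
    have e: "exp (c * ln (real k)) * exp (d * ln (real k)) = exp (a * ln (real k)) * exp (b * ln (real k))"
      by (simp add: assms(5) flip: exp_add distrib_right)
    have "Gamma_series' c k * Gamma_series' d k / (Gamma_series' a k * Gamma_series' b k) =
      (exp (c * ln (real k)) * exp (d * ln (real k))) / (exp (a * ln (real k)) * exp (b * ln (real k))) *
     (pochhammer a k * pochhammer b k / (pochhammer c k * pochhammer d k))"
      using pochhammer_pos[of a k] pochhammer_pos[of b k] pochhammer_pos[of c k] pochhammer_pos[of d k] assms
      by (simp add: Gamma_series'_def divide_simps)
    then show ?thesis unfolding e by simp
  qed
  ultimately show ?thesis by simp
qed

text \<open>The complex duplication formula on the positive axis, where every factor is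
  real.\<close>

lemma Gamma_legendre_duplication_real:
  fixes x :: real
  assumes "0 < x"
  shows "Gamma x * Gamma (x + 1/2) = 2 powr (1 - 2*x) * sqrt pi * Gamma (2*x)"
proof -
  have "complex_of_real x \<notin> \<int>\<^sub>\<le>\<^sub>0" "complex_of_real (x + 1/2) \<notin> \<int>\<^sub>\<le>\<^sub>0"
    unfolding of_real_in_nonpos_Ints_iff using assms nonpos_Ints_nonpos[of x] nonpos_Ints_nonpos[of "x + 1/2"]
    by auto
  then have "Gamma (complex_of_real x) * Gamma (complex_of_real (x + 1/2)) =
      exp (complex_of_real ((1 - 2 * x) * ln 2)) * complex_of_real (sqrt pi) * Gamma (complex_of_real (2 * x))"
    using Gamma_legendre_duplication[of "complex_of_real x"] by simp
  then have "complex_of_real (Gamma x * Gamma (x + 1/2)) =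
      complex_of_real (exp ((1 - 2 * x) * ln 2) * sqrt pi * Gamma (2 * x))"
    by (simp only: Gamma_complex_of_real exp_of_real flip: of_real_mult)
  then show ?thesis by (simp only: of_real_eq_iff powr_def) simp
qed

text \<open>
  The even part of the series has coefficient ratio to \<open>(1 - s\<^sup>2)\<^sup>1\<^sup>/\<^sup>2\<^sup>-\<^sup>p\<close> tending to a quotient of Gamma
  values, which the duplication formula matches with the normalisation \<open>c_alpha\<close>. Only the lower
  bound on the mass is needed, because one divides by it in the end.
\<close>

lemma K_mass_lower:
  assumes \<alpha>: "-1 < \<alpha>" and y: "y < 2 * pi"
  shows "eventually (\<lambda>\<rho>. y < K_scale \<alpha> \<rho> *
    (half_int (1 + \<alpha>/2) (K_ecc \<rho>) + half_int (1 + \<alpha>/2) (- K_ecc \<rho>))) (at_left 1)"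
proof -
  define p where "p = 1 + \<alpha>/2"
  have p: "1/2 < p" "\<alpha> = 2 * p - 2" using \<alpha> by (auto simp: p_def)
  define a where "a = (\<lambda>k. 2 * pi * (pochhammer (p/2) k * pochhammer ((p+1)/2) k / (fact k * fact k)))"
  \<comment> \<open>The comparison series is that of (1 - u)^-(p - 1/2): this exponent balances the
    Pochhammer parameters, as p/2 + (p+1)/2 = 1 + (p - 1/2).\<close>
  define b where "b = (\<lambda>k. pochhammer (p - 1/2) k / fact k)"
  define A where "A = (\<lambda>u. half_int p (sqrt u) + half_int p (- sqrt u))"
  define B where "B = (\<lambda>u::real. (1 - u) powr - (p - 1/2))"
  \<comment> \<open>\<open>?L\<close> will be the limit of the coefficient ratio, \<open>?D\<close>
    that of \<open>K_scale \<alpha> \<rho> * B ((K_ecc \<rho>)\<^sup>2)\<close>.\<close>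
  let ?L = "2 * pi * (Gamma 1 * Gamma (p - 1/2) / (Gamma (p/2) * Gamma ((p+1)/2)))"
  let ?D = "c_alpha \<alpha> * 2 powr (p - 1)"
  have ev: "eventually (\<lambda>\<rho>::real. 0 \<le> \<rho> \<and> \<rho> < 1) (at_left 1)"
    unfolding eventually_at_left_field by (intro exI[of _ 0]) auto
  have Gp: "0 < Gamma (p/2)" "0 < Gamma ((p+1)/2)" "0 < Gamma (p - 1/2)" "0 < Gamma p" "0 < Gamma (2 * p - 1)"
    using p by (auto intro!: Gamma_real_pos)
  have LD: "?L * ?D = 2 * pi"
  proof -
    have 1: "Gamma (p/2) * Gamma ((p+1)/2) = 2 powr (1 - p) * sqrt pi * Gamma p"
      using Gamma_legendre_duplication_real[of "p/2"] p by (simp add: add_divide_distrib)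
    have 2: "Gamma (p - 1/2) * Gamma p = 2 powr (2 - 2 * p) * sqrt pi * Gamma (2 * p - 1)"
      using Gamma_legendre_duplication_real[of "p - 1/2"] p by simp
    have 3: "c_alpha \<alpha> = (Gamma p)\<^sup>2 / Gamma (2 * p - 1)"
      unfolding c_alpha_def p(2) by (simp add: diff_divide_distrib)
    have "?L * ?D = 2 * pi * (Gamma (p - 1/2) * Gamma p) * Gamma p * 2 powr (p - 1) /
       (2 powr (1 - p) * sqrt pi * Gamma p * Gamma (2 * p - 1))"
      unfolding 1 3 by (simp add: power2_eq_square)
    also have "\<dots> = 2 * pi * (2 powr (2 - 2 * p) * 2 powr (p - 1) / 2 powr (1 - p))"
      unfolding 2 using Gp(4,5)[THEN less_imp_neq] by simp
    also have "2 powr (2 - 2 * p) * 2 powr (p - 1) / 2 powr (1 - p) = 1"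
      by (simp flip: powr_add powr_diff)
    finally show ?thesis by simp
  qed
  have "eventually (\<lambda>\<rho>. y < K_scale \<alpha> \<rho> * A ((K_ecc \<rho>)\<^sup>2)) (at_left 1)"
  proof (rule abelian_lower_bound[where a = a and b = b and A = A and B = B and w = "K_scale \<alpha>" and x = "\<lambda>\<rho>. (K_ecc \<rho>)\<^sup>2" and L = ?L and D = ?D])
    have "(\<lambda>k. 2 * pi * (pochhammer (p/2) k * pochhammer ((p+1)/2) k / (pochhammer 1 k * pochhammer (p - 1/2) k)))
      \<longlonglongrightarrow> ?L"
      by (intro tendsto_mult tendsto_const pochhammer_ratio_tendsto) (use p in \<open>auto simp: field_simps\<close>)
    then show "(\<lambda>k. a k / b k) \<longlonglongrightarrow> ?L"
      by (simp add: a_def b_def flip: pochhammer_fact)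
    show "0 < b k" for k using p unfolding b_def by (intro divide_pos_pos pochhammer_pos) auto
    fix u :: real assume u: "0 \<le> u" "u < 1"
    show "(\<lambda>k. a k * u ^ k) sums A u"
      using half_int_even_sums[of "sqrt u" p] u p unfolding a_def A_def by (simp add: mult.assoc)
    show "(\<lambda>k. b k * u ^ k) sums B u"
      using binomial_series_neg_powr[of u "p - 1/2"] u unfolding b_def B_def by simp
  next
    show "\<forall>\<^sub>F \<rho> in at_left 1. 0 \<le> (K_ecc \<rho>)\<^sup>2 \<and> (K_ecc \<rho>)\<^sup>2 < 1"
      using ev by eventually_elim (use K_ecc_bounds in \<open>simp add: abs_square_less_1\<close>)
    show "\<forall>\<^sub>F \<rho> in at_left 1. 0 \<le> K_scale \<alpha> \<rho>"
      using ev by eventually_elim (use K_scale_pos[OF \<alpha>] in \<open>simp add: less_imp_le\<close>)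
    \<comment> \<open>The base 1 - \<rho>^2 tends to 0 and stays nonnegative, so its power with
      exponent \<alpha> + 1 > 0 tends to 0 as well.\<close>
    have "\<forall>\<^sub>F \<rho> in at_left 1. 0 \<le> 1 - (\<rho>::real)\<^sup>2"
      using ev by eventually_elim (simp add: power_le_one)
    then have "(K_scale \<alpha> \<longlongrightarrow> c_alpha \<alpha> * (1 - 1\<^sup>2) powr (\<alpha> + 1) * (1 + 1\<^sup>2) powr (- (1 + \<alpha>/2))) (at_left 1)"
      unfolding K_scale_def using \<alpha> by (auto intro!: tendsto_eq_intros tendsto_powr')
    then show "(K_scale \<alpha> \<longlongrightarrow> 0) (at_left 1)" by simp
    \<comment> \<open>The powers of 1 - \<rho>^2 in \<open>K_scale\<close> and \<open>B\<close> have
      opposite exponents, so their product is this function, continuous at 1.\<close>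
    have "((\<lambda>\<rho>::real. c_alpha \<alpha> * (1 + \<rho>\<^sup>2) powr (p - 1)) \<longlongrightarrow> c_alpha \<alpha> * (1 + 1\<^sup>2) powr (p - 1)) (at_left 1)"
      by (intro tendsto_intros) auto
    moreover have "\<forall>\<^sub>F \<rho> in at_left 1. c_alpha \<alpha> * (1 + \<rho>\<^sup>2) powr (p - 1) = K_scale \<alpha> \<rho> * B ((K_ecc \<rho>)\<^sup>2)"
      using ev
    proof eventually_elim
      case (elim \<rho>)
      have q: "0 < 1 - \<rho>\<^sup>2" "0 < 1 + \<rho>\<^sup>2" using elim by (auto simp: add_pos_nonneg abs_square_less_1)
      have "B ((K_ecc \<rho>)\<^sup>2) = ((1 - \<rho>\<^sup>2) / (1 + \<rho>\<^sup>2)) powr (2 * - (p - 1/2))"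
        unfolding B_def one_minus_K_ecc_sq using q powr_powr[of "(1 - \<rho>\<^sup>2) / (1 + \<rho>\<^sup>2)" 2 "- (p - 1/2)"]
        by simp
      also have "\<dots> = (1 - \<rho>\<^sup>2) powr (1 - 2 * p) / (1 + \<rho>\<^sup>2) powr (1 - 2 * p)"
        using q by (simp add: powr_divide algebra_simps)
      moreover have "\<alpha> + 1 = 2 * p - 1" by (simp add: p_def)
      then have "K_scale \<alpha> \<rho> = c_alpha \<alpha> * (1 - \<rho>\<^sup>2) powr (2 * p - 1) * (1 + \<rho>\<^sup>2) powr (- p)"
        unfolding K_scale_def p_def[symmetric] by (simp only:)
      ultimately have "K_scale \<alpha> \<rho> * B ((K_ecc \<rho>)\<^sup>2) = c_alpha \<alpha> *
         ((1 - \<rho>\<^sup>2) powr (2 * p - 1) * (1 - \<rho>\<^sup>2) powr (1 - 2 * p)) *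
         ((1 + \<rho>\<^sup>2) powr (- p) / (1 + \<rho>\<^sup>2) powr (1 - 2 * p))"
        by simp
      also have "\<dots> = c_alpha \<alpha> * (1 + \<rho>\<^sup>2) powr (p - 1)"
        using q by (simp flip: powr_add powr_diff)
      finally show ?case by simp
    qed
    ultimately show "((\<lambda>\<rho>. K_scale \<alpha> \<rho> * B ((K_ecc \<rho>)\<^sup>2)) \<longlongrightarrow> ?D) (at_left 1)"
      using tendsto_cong by force
    show "0 < ?D" using c_alpha_pos[OF \<alpha>] by simp
    show "y < ?L * ?D" using y LD by simp
  qed
  then show ?thesis using ev
    by eventually_elim (use K_ecc_bounds in \<open>simp add: A_def p_def\<close>)
qed

section \<open>Boundary functions are contractive in the weak sense\<close>

text \<open>A finite measure of mass 2 pi, so that bounded measurable functions are integrable and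
  Fubini applies on the square.\<close>

definition circle_measure :: "real measure" where
  "circle_measure = restrict_space lborel {0..2*pi}"

lemma integral_circle_measure:
  fixes f :: "real \<Rightarrow> 'a::{banach, second_countable_topology}"
  shows "integral\<^sup>L circle_measure f = (LINT t:{0..2*pi}|lborel. f t)"
  unfolding circle_measure_def set_lebesgue_integral_def by (rule integral_restrict_space) simp

lemma borel_measurable_circle_measure [measurable (raw)]:
  "f \<in> borel_measurable borel \<Longrightarrow> f \<in> borel_measurable circle_measure"
  unfolding circle_measure_def by (rule measurable_restrict_space1) simp

lemma emeasure_circle_measure: "emeasure circle_measure (space circle_measure) = ennreal (2 * pi)"
  unfolding circle_measure_def by (simp add: emeasure_restrict_space space_restrict_space)

interpretation circle: finite_measure circle_measure
  by (rule finite_measureI) (simp add: emeasure_circle_measure)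

interpretation circle_pair: pair_sigma_finite circle_measure circle_measure ..

lemma measure_circle_measure: "measure circle_measure (space circle_measure) = 2 * pi"
  by (simp add: measure_def emeasure_circle_measure)

lemma integral_circle_measure_continuous:
  fixes f :: "real \<Rightarrow> real"
  assumes "continuous_on {0..2*pi} f"
  shows "integral\<^sup>L circle_measure f = integral {0..2*pi} f"
  unfolding integral_circle_measure
  by (intro set_borel_integral_eq_integral(2) borel_integrable_atLeastAtMost' assms)

lemma circle_integrable_bounded:
  fixes f :: "real \<Rightarrow> 'a::{banach, second_countable_topology}"
  assumes "f \<in> borel_measurable circle_measure" "\<And>t. norm (f t) \<le> B"
  shows "integrable circle_measure f"
  using assms by (intro circle.integrable_const_bound) auto

section \<open>Continuity and size of the kernel\<close>

lemma continuous_on_K_alpha: "continuous_on (ball 0 1) (K_alpha \<alpha>)"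
proof -
  have "1 - z \<noteq> 0" "1 - (cmod z)\<^sup>2 \<noteq> 0" if "z \<in> ball 0 1" for z :: complex
    using that abs_square_less_1[of "cmod z"] by auto
  then show ?thesis
    unfolding K_alpha_def by (intro continuous_intros) auto
qed

lemma K_alpha_nonneg: "-1 < \<alpha> \<Longrightarrow> 0 \<le> K_alpha \<alpha> z"
  unfolding K_alpha_def using c_alpha_pos[of \<alpha>] by (intro divide_nonneg_nonneg mult_nonneg_nonneg) auto

text \<open>The distance from \<rho> w to w is 1 - \<rho>, which is at most
  \<open>cmod (1 - of_real \<rho> * w)\<close>; hence \<open>cmod (1 - w)\<close> is at most twice
  the latter. Away from its peak the kernel thus tends to 0 uniformly as \<rho> tends to 1.\<close>

lemma K_alpha_away:
  assumes "-1 < \<alpha>" "0 \<le> \<rho>" "\<rho> < 1" "0 < \<delta>" "\<delta> \<le> cmod (1 - w)" "cmod w = 1"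
  shows "K_alpha \<alpha> (of_real \<rho> * w) \<le> c_alpha \<alpha> * (1 - \<rho>\<^sup>2) powr (\<alpha> + 1) / (\<delta>/2) powr (\<alpha> + 2)"
proof -
  have "cmod (1 - w) \<le> cmod (1 - of_real \<rho> * w) + cmod (of_real \<rho> * w - w)"
    using norm_triangle_ineq[of "1 - of_real \<rho> * w" "of_real \<rho> * w - w"] by simp
  also have "cmod (of_real \<rho> * w - w) = cmod (of_real (\<rho> - 1) * w)" by (simp add: algebra_simps)
  also have "\<dots> = 1 - \<rho>" unfolding norm_mult norm_of_real using assms by simp
  also have "1 - \<rho> \<le> cmod (1 - of_real \<rho> * w)"
    using norm_triangle_ineq2[of 1 "of_real \<rho> * w"] assms by (simp add: norm_mult)
  finally have "\<delta>/2 \<le> cmod (1 - of_real \<rho> * w)" using assms by simp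
  then have "(\<delta>/2) powr (\<alpha> + 2) \<le> cmod (1 - of_real \<rho> * w) powr (\<alpha> + 2)"
    using assms by (intro powr_mono2) auto
  then show ?thesis
    unfolding K_alpha_def using assms c_alpha_pos[of \<alpha>]
    by (simp add: norm_mult frac_le)
qed

text \<open>
  Testing against a continuous \<open>G\<close> avoids pointwise radial limits: integrate \<open>G\<close> against the
  extension of \<open>H\<close> on the circle of radius \<open>\<rho>\<close>, move the kernel onto \<open>G\<close> by Fubini, and let
  \<open>\<rho>\<close> tend to 1. There \<open>A\<close> is the mass of the kernel and \<open>E\<close> the error of approximating \<open>A * G\<close>.
\<close>

lemma weak_contraction:
  fixes H :: "real \<Rightarrow> complex" and G :: "complex \<Rightarrow> real"
  assumes \<alpha>: "-1 < \<alpha>"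
    and H[measurable]: "H \<in> borel_measurable borel" and M: "0 < M" "\<And>t. cmod (H t) \<le> M"
    and G: "continuous_on (sphere 0 1) G"
    and contr: "\<And>\<rho> t. 0 \<le> \<rho> \<Longrightarrow> \<rho> < 1 \<Longrightarrow>
      cmod (LINT s|circle_measure. of_real (K_alpha \<alpha> (of_real \<rho> * cis (t - s))) * H s) \<le> 2 * pi"
  shows "cmod (LINT t|circle_measure. of_real (G (cis t)) * H t) \<le> (LINT t|circle_measure. \<bar>G (cis t)\<bar>)"
proof -
  let ?N = circle_measure
  define X where "X = (LINT t|?N. of_real (G (cis t)) * H t)"
  define I where "I = (LINT t|?N. \<bar>G (cis t)\<bar>)"
  have Gc: "continuous_on UNIV (\<lambda>t. G (cis t))"
    by (rule continuous_on_compose2[OF G]) (auto intro!: continuous_intros)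
  then have Gm[measurable]: "(\<lambda>t. G (cis t)) \<in> borel_measurable borel"
    by (rule borel_measurable_continuous_onI)
  obtain B where B: "0 < B" "\<And>t. \<bar>G (cis t)\<bar> \<le> B"
  proof -
    have "bounded (G ` sphere 0 1)"
      by (intro compact_imp_bounded compact_continuous_image G compact_sphere)
    then obtain B where "0 < B" "\<forall>x\<in>G ` sphere 0 1. norm x \<le> B" by (auto simp: bounded_pos)
    then show ?thesis by (intro that[of B]) auto
  qed
  have I0: "0 \<le> I" unfolding I_def by simp
  have "cmod X \<le> I + e" if e: "0 < e" for e
  proof (rule ccontr)
    assume "\<not> cmod X \<le> I + e"
    \<comment> \<open>Chosen so that the error from the continuity of G in \<open>key\<close> is e
      times the mass A; passing from \<open>cmod X\<close> to D absorbs it.\<close>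
    define \<epsilon> where "\<epsilon> = e / (2 * pi * M)"
    have \<epsilon>: "0 < \<epsilon>" "2 * pi * M * \<epsilon> = e" using e M by (auto simp: \<epsilon>_def)
    define D where "D = cmod X - e"
    have D: "I < D" using \<open>\<not> cmod X \<le> I + e\<close> by (simp add: D_def)
    \<comment> \<open>Since I < D, there is a y below the limiting mass 2 pi that still satisfies y
      D > 2 pi I.\<close>
    have "2 * pi * I / D < 2 * pi" using D I0 by (simp add: field_simps)
    then obtain y where y: "2 * pi * I / D < y" "y < 2 * pi" using dense by blast
    have yD: "2 * pi * I < y * D" using y D I0 by (simp add: field_simps)
    obtain \<delta> where \<delta>: "0 < \<delta>"
      "\<And>t s. dist (cis t) (cis s) < \<delta> \<Longrightarrow> \<bar>G (cis t) - G (cis s)\<bar> \<le> \<epsilon>"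
    proof -
      have "uniformly_continuous_on (sphere 0 1) G"
        by (intro compact_uniformly_continuous G compact_sphere)
      from uniformly_continuous_onE[OF this \<epsilon>(1)] obtain d where "0 < d"
        "\<And>x x'. x \<in> sphere 0 1 \<Longrightarrow> x' \<in> sphere 0 1 \<Longrightarrow> dist x' x < d \<Longrightarrow> dist (G x') (G x) < \<epsilon>"
        by blast
      then show ?thesis by (intro that[of d]) (auto simp: dist_real_def intro!: less_imp_le)
    qed
    \<comment> \<open>Bounds the integrand of E off the diagonal: 2 B for the oscillation of G, the
      rest by \<open>K_alpha_away\<close>.\<close>
    define W where "W = (\<lambda>\<rho>. 2 * B * (c_alpha \<alpha> * (1 - \<rho>\<^sup>2) powr (\<alpha> + 1) / (\<delta>/2) powr (\<alpha> + 2)))"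
    have key: "(K_scale \<alpha> \<rho> * (half_int (1 + \<alpha>/2) (K_ecc \<rho>) + half_int (1 + \<alpha>/2) (- K_ecc \<rho>))) * D
       \<le> 2 * pi * I + M * (2 * pi) * (2 * pi) * W \<rho>" if \<rho>: "0 \<le> \<rho>" "\<rho> < 1" for \<rho>
    proof -
      define A where "A = K_scale \<alpha> \<rho> * (half_int (1 + \<alpha>/2) (K_ecc \<rho>) + half_int (1 + \<alpha>/2) (- K_ecc \<rho>))"
      define k where "k = (\<lambda>t. K_alpha \<alpha> (of_real \<rho> * cis t))"
      have kc: "continuous_on UNIV k"
        unfolding k_def using \<rho>
        by (intro continuous_on_compose2[OF continuous_on_K_alpha] continuous_intros) (auto simp: norm_mult)
      then have km[measurable]: "k \<in> borel_measurable borel" by (rule borel_measurable_continuous_onI)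
      have k0: "0 \<le> k t" for t unfolding k_def by (rule K_alpha_nonneg[OF \<alpha>])
      obtain Bk where Bk: "\<And>t. k t \<le> Bk"
      proof -
        have "continuous_on (sphere 0 1) (\<lambda>w. K_alpha \<alpha> (of_real \<rho> * w))"
          using \<rho> by (intro continuous_on_compose2[OF continuous_on_K_alpha] continuous_intros) (auto simp: norm_mult)
        then have "bounded ((\<lambda>w. K_alpha \<alpha> (of_real \<rho> * w)) ` sphere 0 1)"
          by (intro compact_imp_bounded compact_continuous_image compact_sphere)
        then obtain b where b: "\<forall>x\<in>(\<lambda>w. K_alpha \<alpha> (of_real \<rho> * w)) ` sphere 0 1. norm x \<le> b" by (auto simp: bounded_iff)
        show ?thesis
        proof (rule that)
          fix t
          have "norm (k t) \<le> b" using b unfolding k_def by simp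
          then show "k t \<le> b" by simp
        qed
      qed
      have Bk0: "0 \<le> Bk" using k0 Bk order_trans by blast
      have kA: "(LINT t|?N. k (t - s)) = A" for s
      proof -
        have "continuous_on {0..2*pi} (\<lambda>t. k (t - s))"
          by (rule continuous_on_compose2[OF kc]) (auto intro!: continuous_intros)
        then show ?thesis
          using integral_circle_measure_continuous integral_K_alpha[OF \<rho>, of \<alpha> s]
          by (simp add: A_def k_def)
      qed
      have ki: "integrable ?N (\<lambda>t. k (t - s))" for s
        by (rule circle_integrable_bounded[where B = Bk]) (use k0 Bk in auto)
      have Gki: "integrable ?N (\<lambda>t. G (cis t) * k (t - s))" for s
        by (rule circle_integrable_bounded[where B = "B * Bk"])
          (use k0 Bk B in \<open>auto simp: abs_mult intro!: mult_mono less_imp_le[OF B(1)]\<close>)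
      define E where "E = (\<lambda>s. LINT t|?N. (G (cis t) - G (cis s)) * k (t - s))"
      have E: "(LINT t|?N. G (cis t) * k (t - s)) = A * G (cis s) + E s" for s
        unfolding E_def left_diff_distrib using ki Gki kA by simp
      have Eb: "\<bar>E s\<bar> \<le> \<epsilon> * A + 2 * pi * W \<rho>" for s
      proof -
        \<comment> \<open>Near the diagonal G varies by at most \<epsilon>; elsewhere the kernel is
          small.\<close>
        have pt: "\<bar>(G (cis t) - G (cis s)) * k (t - s)\<bar> \<le> \<epsilon> * k (t - s) + W \<rho>" for t
        proof (cases "dist (cis t) (cis s) < \<delta>")
          case True
          have "0 \<le> W \<rho>" unfolding W_def using B c_alpha_pos[OF \<alpha>] by simp
          moreover have "\<bar>(G (cis t) - G (cis s)) * k (t - s)\<bar> \<le> \<epsilon> * k (t - s)"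
            using \<delta>(2)[OF True] k0[of "t - s"] by (simp add: abs_mult mult_right_mono)
          ultimately show ?thesis by linarith
        next
          case False
          have "cis t - cis s = cis s * (cis (t - s) - 1)" by (simp add: right_diff_distrib cis_mult)
          then have "dist (cis t) (cis s) = cmod (1 - cis (t - s))"
            by (simp add: dist_norm norm_mult norm_minus_commute)
          then have "k (t - s) \<le> c_alpha \<alpha> * (1 - \<rho>\<^sup>2) powr (\<alpha> + 1) / (\<delta>/2) powr (\<alpha> + 2)"
            unfolding k_def using False \<delta>(1) \<alpha> \<rho> by (intro K_alpha_away) auto
          moreover have "\<bar>G (cis t) - G (cis s)\<bar> \<le> 2 * B" using B(2)[of t] B(2)[of s] by linarith
          ultimately have "\<bar>(G (cis t) - G (cis s)) * k (t - s)\<bar> \<le> W \<rho>"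
            unfolding W_def using k0[of "t - s"] B(1) by (simp only: abs_mult abs_of_nonneg) (intro mult_mono, auto)
          then show ?thesis using \<epsilon>(1) k0[of "t - s"] by (smt (verit) mult_nonneg_nonneg)
        qed
        have i1: "integrable ?N (\<lambda>t. \<epsilon> * k (t - s) + W \<rho>)" using ki by simp
        have i2: "integrable ?N (\<lambda>t. (G (cis t) - G (cis s)) * k (t - s))"
          unfolding left_diff_distrib using ki Gki by simp
        have "\<bar>E s\<bar> \<le> (LINT t|?N. \<bar>(G (cis t) - G (cis s)) * k (t - s)\<bar>)"
          unfolding E_def using integral_norm_bound[of ?N "\<lambda>t. (G (cis t) - G (cis s)) * k (t - s)"] by simp
        also have "\<dots> \<le> (LINT t|?N. \<epsilon> * k (t - s) + W \<rho>)"
          by (intro integral_mono i1 integrable_abs i2 pt)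
        also have "\<dots> = \<epsilon> * A + 2 * pi * W \<rho>"
          using ki kA by (simp add: measure_circle_measure)
        finally show ?thesis .
      qed
      have fst_m[measurable]: "fst \<in> borel_measurable (?N \<Otimes>\<^sub>M ?N)"
        using measurable_compose[OF measurable_fst borel_measurable_circle_measure[of "\<lambda>x. x"]] by simp
      have snd_m[measurable]: "snd \<in> borel_measurable (?N \<Otimes>\<^sub>M ?N)"
        using measurable_compose[OF measurable_snd borel_measurable_circle_measure[of "\<lambda>x. x"]] by simp
      have Em: "E \<in> borel_measurable ?N"
      proof -
        have "E = (\<lambda>s. (LINT t|?N. G (cis t) * k (t - s)) - A * G (cis s))" by (simp add: E)
        then show ?thesis by (rule ssubst) measurable
      qed
      have GHi: "integrable ?N (\<lambda>s. of_real (G (cis s)) * H s)"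
        by (rule circle_integrable_bounded[where B = "B * M"])
          (use B M in \<open>auto simp: norm_mult intro!: mult_mono less_imp_le[OF B(1)]\<close>)
      have EH: "cmod (of_real (E s) * H s) \<le> (\<epsilon> * A + 2 * pi * W \<rho>) * M" for s
        unfolding norm_mult using Eb[of s] M by (intro mult_mono) auto
      have EHi: "integrable ?N (\<lambda>s. of_real (E s) * H s)"
        by (rule circle_integrable_bounded[where B = "(\<epsilon> * A + 2 * pi * W \<rho>) * M", OF _ EH])
          (use Em in measurable)
      let ?F = "\<lambda>t s. of_real (G (cis t) * k (t - s)) * H s"
      have Fb: "cmod (?F t s) \<le> B * Bk * M" for t s
        unfolding norm_mult norm_of_real abs_mult using k0 Bk Bk0 B M less_imp_le[OF B(1)]
        by (intro mult_mono) auto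
      have Fs: "integrable ?N (?F t)" for t
        by (rule circle_integrable_bounded[OF _ Fb]) measurable
      have Fi: "integrable (?N \<Otimes>\<^sub>M ?N) (case_prod ?F)"
      proof (rule circle_pair.Fubini_integrable)
        show "integrable ?N (\<lambda>x. LINT y|?N. norm (case_prod ?F (x, y)))"
        proof (rule circle_integrable_bounded[where B = "2 * pi * (B * Bk * M)"])
          fix t
          have "(LINT y|?N. cmod (?F t y)) \<le> (LINT y|?N. B * Bk * M)"
            by (intro integral_mono integrable_norm Fs Fb) simp
          moreover have "0 \<le> (LINT y|?N. cmod (?F t y))"
            by (rule Bochner_Integration.integral_nonneg) simp
          ultimately show "norm (LINT y|?N. norm (case_prod ?F (t, y))) \<le> 2 * pi * (B * Bk * M)"
            by (simp only: prod.case real_norm_def abs_of_nonneg) (simp add: measure_circle_measure)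
        qed measurable
        show "AE x in ?N. integrable ?N (\<lambda>y. case_prod ?F (x, y))"
          using Fs by simp
      qed measurable
      \<comment> \<open>Integrating over t first yields A G + E; integrating over s first yields the
        extension of H, which \<open>contr\<close> bounds.\<close>
      have "(LINT s|?N. (LINT t|?N. ?F t s)) = (LINT t|?N. (LINT s|?N. ?F t s))"
        using circle_pair.Fubini_integral[OF Fi] .
      also have "(\<lambda>s. LINT t|?N. ?F t s) = (\<lambda>s. of_real A * (of_real (G (cis s)) * H s) + of_real (E s) * H s)"
      proof
        fix s
        have "(LINT t|?N. ?F t s) = of_real (LINT t|?N. G (cis t) * k (t - s)) * H s"
          by (simp only: integral_mult_left_zero integral_complex_of_real)
        then show "(LINT t|?N. ?F t s) = of_real A * (of_real (G (cis s)) * H s) + of_real (E s) * H s"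
          unfolding E by (simp add: algebra_simps)
      qed
      also have "(LINT s|?N. of_real A * (of_real (G (cis s)) * H s) + of_real (E s) * H s) =
          of_real A * X + (LINT s|?N. of_real (E s) * H s)"
        unfolding X_def using GHi EHi by simp
      also have "(\<lambda>t. LINT s|?N. ?F t s) = (\<lambda>t. of_real (G (cis t)) * (LINT s|?N. of_real (k (t - s)) * H s))"
        by (simp add: mult.assoc)
      finally have eq: "of_real A * X = (LINT t|?N. of_real (G (cis t)) * (LINT s|?N. of_real (k (t - s)) * H s))
          - (LINT s|?N. of_real (E s) * H s)"
        by (simp add: eq_diff_eq)
      have n1: "cmod (LINT t|?N. of_real (G (cis t)) * (LINT s|?N. of_real (k (t - s)) * H s)) \<le> 2 * pi * I"
      proof -
        have "cmod (LINT t|?N. of_real (G (cis t)) * (LINT s|?N. of_real (k (t - s)) * H s))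
          \<le> (LINT t|?N. \<bar>G (cis t)\<bar> * (2 * pi))"
        proof (rule Bochner_Integration.integral_norm_bound_integral)
          fix t
          show b: "cmod (of_real (G (cis t)) * (LINT s|?N. of_real (k (t - s)) * H s)) \<le> \<bar>G (cis t)\<bar> * (2 * pi)" for t
            unfolding norm_mult k_def using contr[OF \<rho>, of t] by (intro mult_mono) auto
          show "integrable ?N (\<lambda>t. of_real (G (cis t)) * (LINT s|?N. of_real (k (t - s)) * H s))"
          proof (rule circle_integrable_bounded)
            show "cmod (of_real (G (cis t)) * (LINT s|?N. of_real (k (t - s)) * H s)) \<le> B * (2 * pi)" for t
              using order_trans[OF b[of t] mult_right_mono[OF B(2)[of t], of "2 * pi"]] by simp
          qed measurable
          show "integrable ?N (\<lambda>t. \<bar>G (cis t)\<bar> * (2 * pi))"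
            by (rule circle_integrable_bounded[where B = "B * (2 * pi)"]) (use B in auto)
        qed
        then show ?thesis by (simp add: I_def mult.commute)
      qed
      have n2: "cmod (LINT s|?N. of_real (E s) * H s) \<le> 2 * pi * ((\<epsilon> * A + 2 * pi * W \<rho>) * M)"
      proof -
        have "cmod (LINT s|?N. of_real (E s) * H s) \<le> (LINT s|?N. (\<epsilon> * A + 2 * pi * W \<rho>) * M)"
          by (rule Bochner_Integration.integral_norm_bound_integral[OF EHi _ EH]) simp
        then show ?thesis by (simp add: measure_circle_measure mult_ac)
      qed
      have A0: "0 \<le> A" using kA[of 0, symmetric] k0 by simp
      have "A * cmod X = cmod (of_real A * X)" using A0 by (simp add: norm_mult)
      also have "\<dots> \<le> 2 * pi * I + 2 * pi * ((\<epsilon> * A + 2 * pi * W \<rho>) * M)"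
        unfolding eq using norm_triangle_ineq4 n1 n2 by (meson add_mono order_trans)
      also have "\<dots> = 2 * pi * I + A * (2 * pi * M * \<epsilon>) + M * (2 * pi) * (2 * pi) * W \<rho>"
        by (simp add: algebra_simps)
      finally show ?thesis unfolding \<epsilon>(2) D_def A_def[symmetric] by (simp add: algebra_simps)
    qed
    have ev: "eventually (\<lambda>\<rho>::real. 0 \<le> \<rho> \<and> \<rho> < 1) (at_left 1)"
      unfolding eventually_at_left_field by (intro exI[of _ 0]) auto
    then have "\<forall>\<^sub>F \<rho> in at_left 1. 0 \<le> 1 - (\<rho>::real)\<^sup>2"
      by eventually_elim (simp add: power_le_one)
    then have "((\<lambda>\<rho>. M * (2 * pi) * (2 * pi) * W \<rho>) \<longlongrightarrow> 0) (at_left 1)"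
      unfolding W_def using \<alpha> \<delta>(1) by (auto intro!: tendsto_eq_intros tendsto_powr')
    then have "\<forall>\<^sub>F \<rho> in at_left 1. M * (2 * pi) * (2 * pi) * W \<rho> < y * D - 2 * pi * I"
      by (rule order_tendstoD) (use yD in simp)
    \<comment> \<open>Near \<rho> = 1 the estimate \<open>key\<close> gives A D < y D although A > y
      and D > 0. The filter is nontrivial, so this is a contradiction.\<close>
    with K_mass_lower[OF \<alpha> y(2)] ev have "\<forall>\<^sub>F \<rho> in at_left (1::real). False"
    proof eventually_elim
      case (elim \<rho>)
      from key[of \<rho>] elim have "(K_scale \<alpha> \<rho> * (half_int (1 + \<alpha>/2) (K_ecc \<rho>) + half_int (1 + \<alpha>/2) (- K_ecc \<rho>))) * D < y * D"
        by auto
      then show ?case using elim(1) D I0 by (simp add: mult_less_cancel_right)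
    qed
    then show False by (simp add: trivial_limit_at_left_real)
  qed
  then have "cmod X \<le> I" by (rule field_le_epsilon)
  then show ?thesis unfolding X_def I_def .
qed

section \<open>The sharp bound\<close>

text \<open>With p = 1 + \<alpha>/2, the denominator (1 + r^2)^(p+1) gives p factors to
  \<open>K_scale\<close> and one to \<open>K_ecc\<close>, and the argument of the series is the
  square of \<open>K_ecc r\<close>.\<close>

lemma bound_rhs_eq_half_int:
  assumes \<alpha>: "-1 < \<alpha>" and r: "0 \<le> r" "r < 1"
  shows "bound_rhs \<alpha> r = K_scale \<alpha> r * (half_int (1 + \<alpha>/2) (K_ecc r) - half_int (1 + \<alpha>/2) (- K_ecc r)) / (2 * pi)"
proof -
  define p where "p = 1 + \<alpha>/2"
  have p: "0 < p" "1 + \<alpha>/4 = (p + 1)/2" "3/2 + \<alpha>/4 = (p + 2)/2" "2 + \<alpha>/2 = p + 1" "2 + \<alpha> = 2 * p"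
    using \<alpha> by (auto simp: p_def field_simps)
  have s: "\<bar>K_ecc r\<bar> < 1" using K_ecc_bounds[OF r] by simp
  have q: "0 < 1 + r\<^sup>2" by (simp add: add_pos_nonneg)
  have "(1 + r\<^sup>2) powr (p + 1) = (1 + r\<^sup>2) powr p * (1 + r\<^sup>2)"
    using q by (simp add: powr_add)
  moreover have "4 * r\<^sup>2 / (1 + r\<^sup>2)\<^sup>2 = (K_ecc r)\<^sup>2" by (simp add: K_ecc_def power_divide power_mult_distrib)
  ultimately have "bound_rhs \<alpha> r = K_scale \<alpha> r * (4 * p * K_ecc r * hyp3F2 1 ((p+1)/2) ((p+2)/2) (3/2) (3/2) ((K_ecc r)\<^sup>2)) / (2 * pi)"
    unfolding bound_rhs_def K_scale_def c_alpha_def p(2-5) p_def[symmetric] powr_minus_divide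
    using q by (simp add: K_ecc_def add.commute mult_ac)
  then show ?thesis
    unfolding p_def[symmetric] half_int_odd_hyp[OF s p(1)] .
qed

text \<open>The constant \<open>K_scale \<alpha> r\<close> separates the values of the kernel on the
  two half circles, so the absolute values open with opposite signs and the constants
  cancel.\<close>

lemma integral_abs_kernel_minus_median:
  assumes \<alpha>: "-1 < \<alpha>" and r: "0 \<le> r" "r < 1"
  shows "integral {0..2*pi} (\<lambda>t. \<bar>K_alpha \<alpha> (of_real r * cis (t - \<theta>)) - K_scale \<alpha> r\<bar>) = 2 * pi * bound_rhs \<alpha> r"
proof -
  define p where "p = 1 + \<alpha>/2"
  define s where "s = K_ecc r"
  have p: "0 < p" using \<alpha> by (simp add: p_def)
  have s: "0 \<le> s" "\<bar>s\<bar> < 1" using K_ecc_bounds[OF r] by (auto simp: s_def)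
  have S: "0 < K_scale \<alpha> r" by (rule K_scale_pos[OF \<alpha> r])
  have "integral {0..2*pi} (\<lambda>t. \<bar>K_alpha \<alpha> (of_real r * cis (t - \<theta>)) - K_scale \<alpha> r\<bar>) =
    integral {0..2*pi} (\<lambda>t. \<bar>K_scale \<alpha> r * (1 - s * cos (t - \<theta>)) powr (- p) - K_scale \<alpha> r\<bar>)"
    unfolding K_alpha_polar[OF r] p_def s_def ..
  also have "\<dots> = integral {-(pi/2)..pi/2} (\<lambda>t. \<bar>K_scale \<alpha> r * (1 - s * cos t) powr (- p) - K_scale \<alpha> r\<bar> +
      \<bar>K_scale \<alpha> r * (1 - s * (- cos t)) powr (- p) - K_scale \<alpha> r\<bar>)"
    by (rule integral_cos_shift) (intro continuous_intros continuous_on_kernel_profile s)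
  also have "\<dots> = integral {-(pi/2)..pi/2} (\<lambda>t. K_scale \<alpha> r * ((1 - s * cos t) powr (- p) - (1 - (- s) * cos t) powr (- p)))"
  proof (rule integral_cong)
    fix t assume t: "t \<in> {-(pi/2)..pi/2}"
    then have c: "0 \<le> s * cos t" using s cos_ge_zero[of t] by simp
    have c': "0 < 1 - s * cos t" by (rule one_minus_mult_cos_pos[OF s(2)])
    have "1 \<le> (1 - s * cos t) powr (- p)"
      using powr_mono2'[of "- p" "1 - s * cos t" 1] p c c' by simp
    moreover have "(1 + s * cos t) powr (- p) \<le> 1"
      using powr_mono2'[of "- p" 1 "1 + s * cos t"] p c by simp
    ultimately have "K_scale \<alpha> r * 1 \<le> K_scale \<alpha> r * (1 - s * cos t) powr (- p)"
      "K_scale \<alpha> r * (1 + s * cos t) powr (- p) \<le> K_scale \<alpha> r * 1"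
      using S by (auto intro!: mult_left_mono simp del: mult_1_right)
    then show "\<bar>K_scale \<alpha> r * (1 - s * cos t) powr (- p) - K_scale \<alpha> r\<bar> +
      \<bar>K_scale \<alpha> r * (1 - s * (- cos t)) powr (- p) - K_scale \<alpha> r\<bar> =
      K_scale \<alpha> r * ((1 - s * cos t) powr (- p) - (1 - (- s) * cos t) powr (- p))"
      by (simp add: right_diff_distrib)
  qed
  also have "\<dots> = K_scale \<alpha> r * (half_int p s - half_int p (- s))"
    by (intro integral_unique has_integral_mult_right has_integral_diff has_integral_half_int) (use s in auto)
  also have "\<dots> = 2 * pi * bound_rhs \<alpha> r"
    unfolding bound_rhs_eq_half_int[OF \<alpha> r] p_def s_def by simp
  finally show ?thesis .
qed

text \<open>Here p = 1, and for s = \<open>K_ecc r\<close> the argument s / sqrt (1 - s^2) of the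
  arctangent is 2 r / (1 - r^2), the tangent of twice \<open>arctan r\<close>.\<close>

lemma bound_rhs_0:
  assumes r: "0 \<le> r" "r < 1"
  shows "bound_rhs 0 r = 4 / pi * arctan r"
proof -
  have q: "0 < 1 - r\<^sup>2" "0 < 1 + r\<^sup>2" using r by (auto simp: add_pos_nonneg abs_square_less_1)
  have s: "\<bar>K_ecc r\<bar> < 1" using K_ecc_bounds[OF r] by simp
  have root: "sqrt (1 - (K_ecc r)\<^sup>2) = (1 - r\<^sup>2) / (1 + r\<^sup>2)"
    unfolding one_minus_K_ecc_sq using q by simp
  have "K_ecc r / ((1 - r\<^sup>2) / (1 + r\<^sup>2)) = 2 * r / (1 - r\<^sup>2)"
    unfolding K_ecc_def using q by simp
  moreover have "2 * arctan r = arctan (2 * r / (1 - r\<^sup>2))"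
    using arctan_double[of r] r by simp
  ultimately have h: "half_int 1 (K_ecc r) - half_int 1 (- K_ecc r) = 4 * (1 + r\<^sup>2) / (1 - r\<^sup>2) * (2 * arctan r)"
    unfolding half_int_one_odd[OF s] root using q by (simp add: field_simps)
  have K: "K_scale 0 r = (1 - r\<^sup>2) / (1 + r\<^sup>2)"
    unfolding K_scale_def c_alpha_def using q by (simp add: powr_minus_divide)
  have cancel: "u / v * (4 * v / u * (2 * a)) / (2 * pi) = 4 / pi * a" if "0 < u" "0 < v" for u v a :: real
    using that by simp
  have "bound_rhs 0 r = K_scale 0 r * (half_int 1 (K_ecc r) - half_int 1 (- K_ecc r)) / (2 * pi)"
    using bound_rhs_eq_half_int[of 0 r] r by simp
  also have "\<dots> = 4 / pi * arctan r"
    unfolding h K by (rule cancel[OF q])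
  finally show ?thesis .
qed

theorem theorem3:
  fixes \<alpha> :: real and f fstar :: "complex \<Rightarrow> complex"
  assumes "\<alpha> > -1"
    and meas: "(\<lambda>t. fstar (cis t)) \<in> borel_measurable lborel"
    and bdd: "\<exists>M. AE t in lborel. cmod (fstar (cis t)) \<le> M"
    and harm: "\<And>z. z \<in> ball 0 1 \<Longrightarrow> f z = P_alpha \<alpha> fstar z"
    and self: "\<And>z. z \<in> ball 0 1 \<Longrightarrow> f z \<in> ball 0 1"
    and "f 0 = 0"
  shows "(\<forall>z \<in> ball 0 1. cmod (f z) \<le> bound_rhs \<alpha> (cmod z))
       \<and> (\<forall>r. 0 \<le> r \<and> r < 1 \<longrightarrow> bound_rhs 0 r = 4 / pi * arctan r)"
proof (intro conjI ballI allI impI)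
  note \<alpha> = assms(1)
  obtain M0 where "AE t in lborel. cmod (fstar (cis t)) \<le> M0" using bdd by blast
  then have M0: "AE t in lborel. cmod (fstar (cis t)) \<le> max 1 M0" by eventually_elim simp
  define M where "M = max 1 M0"
  \<comment> \<open>Agrees with \<open>fstar\<close> almost everywhere but is bounded by M at every
    point; M \<ge> 1 ensures positivity.\<close>
  define H where "H = (\<lambda>t. if cmod (fstar (cis t)) \<le> M then fstar (cis t) else 0)"
  have fm[measurable]: "(\<lambda>t. fstar (cis t)) \<in> borel_measurable borel" using meas by simp
  have M: "0 < M" "cmod (H t) \<le> M" for t by (auto simp: M_def H_def)
  have H[measurable]: "H \<in> borel_measurable borel" unfolding H_def by measurable
  have P: "P_alpha \<alpha> fstar z = of_real (1 / (2 * pi)) * (LINT t|circle_measure. of_real (K_alpha \<alpha> (z * cis (- t))) * H t)"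
    if z: "z \<in> ball 0 1" for z
  proof -
    have c: "continuous_on UNIV (\<lambda>t. K_alpha \<alpha> (z * cis (- t)))"
      using z by (intro continuous_on_compose2[OF continuous_on_K_alpha] continuous_intros) (auto simp: norm_mult)
    have [measurable]: "(\<lambda>t. K_alpha \<alpha> (z * cis (- t))) \<in> borel_measurable borel"
      by (rule borel_measurable_continuous_onI[OF c])
    have "(LINT t:{0..2*pi}|lborel. of_real (K_alpha \<alpha> (z * cis (- t))) * fstar (cis t)) =
      (LINT t:{0..2*pi}|lborel. of_real (K_alpha \<alpha> (z * cis (- t))) * H t)"
      unfolding set_lebesgue_integral_def
    proof (rule integral_cong_AE)
      show "AE t in lborel. indicator {0..2*pi} t *\<^sub>R (of_real (K_alpha \<alpha> (z * cis (- t))) * fstar (cis t)) =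
        indicator {0..2*pi} t *\<^sub>R (of_real (K_alpha \<alpha> (z * cis (- t))) * H t)"
        using M0 by eventually_elim (simp add: H_def M_def)
    qed measurable
    then show ?thesis unfolding P_alpha_def integral_circle_measure by simp
  qed
  \<comment> \<open>At the origin the kernel is the nonzero constant
    \<open>c_alpha \<alpha>\<close>.\<close>
  have mean: "(LINT t|circle_measure. H t) = 0"
  proof -
    have "K_alpha \<alpha> 0 = c_alpha \<alpha>" by (simp add: K_alpha_def)
    then show ?thesis
      using P[of 0] harm[of 0] \<open>f 0 = 0\<close> c_alpha_pos[OF \<alpha>] by simp
  qed
  fix z :: complex assume z: "z \<in> ball 0 1"
  define r where "r = cmod z"
  define \<theta> where "\<theta> = Arg z"
  have r: "0 \<le> r" "r < 1" using z by (auto simp: r_def)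
  have zr: "z = of_real r * cis \<theta>"
    unfolding r_def \<theta>_def using rcis_cmod_Arg[of z] by (simp add: rcis_def)
  \<comment> \<open>The conjugate occurs because \<open>cnj (cis t)\<close> is
    \<open>cis (- t)\<close>, as in the Poisson-type integral.\<close>
  define G where "G = (\<lambda>w. K_alpha \<alpha> (z * cnj w) - K_scale \<alpha> r)"
  have G: "continuous_on (sphere 0 1) G"
    unfolding G_def using z
    by (intro continuous_on_diff continuous_on_const continuous_on_compose2[OF continuous_on_K_alpha] continuous_intros)
      (auto simp: norm_mult)
  have Gc: "continuous_on A (\<lambda>t. G (cis t))" for A
    by (rule continuous_on_compose2[OF G]) (auto intro!: continuous_intros)
  have Gcis: "G (cis t) = K_alpha \<alpha> (of_real r * cis (t - \<theta>)) - K_scale \<alpha> r" for t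
  proof -
    have "z * cnj (cis t) = of_real r * cis (\<theta> - t)" by (simp add: zr cis_cnj cis_mult)
    \<comment> \<open>The kernel depends on the angle only through its cosine, so the sign of the
      angle may be changed.\<close>
    then have "K_alpha \<alpha> (z * cnj (cis t)) = K_alpha \<alpha> (of_real r * cis (t - \<theta>))"
      unfolding K_alpha_polar[OF r] by (simp add: K_alpha_polar[OF r] cos_diff mult.commute)
    then show ?thesis by (simp add: G_def)
  qed
  have "(LINT t|circle_measure. of_real (K_alpha \<alpha> (z * cis (- t))) * H t) =
     (LINT t|circle_measure. of_real (G (cis t)) * H t + of_real (K_scale \<alpha> r) * H t)"
    by (simp add: G_def cis_cnj algebra_simps)
  also have "\<dots> = (LINT t|circle_measure. of_real (G (cis t)) * H t) + of_real (K_scale \<alpha> r) * (LINT t|circle_measure. H t)"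
  proof -
    obtain B where B: "\<And>x. x \<in> G ` sphere 0 1 \<Longrightarrow> norm x \<le> B"
      using compact_imp_bounded[OF compact_continuous_image[OF G compact_sphere]] unfolding bounded_iff by blast
    have "integrable circle_measure (\<lambda>t. of_real (G (cis t)) * H t)"
    proof (rule circle_integrable_bounded)
      show "cmod (of_real (G (cis t)) * H t) \<le> B * M" for t
        unfolding norm_mult norm_of_real using B[of "G (cis t)"] M by (intro mult_mono) auto
      show "(\<lambda>t. of_real (G (cis t)) * H t) \<in> borel_measurable circle_measure"
        using borel_measurable_continuous_onI[OF Gc] by measurable
    qed
    moreover have "integrable circle_measure H"
      by (rule circle_integrable_bounded[OF _ M(2)]) measurable
    ultimately show ?thesis by simp
  qed
  \<comment> \<open>The constant subtracted in G drops out by \<open>mean\<close>.\<close>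
  finally have fz: "f z = of_real (1 / (2 * pi)) * (LINT t|circle_measure. of_real (G (cis t)) * H t)"
    using harm[OF z] P[OF z] mean by simp
  have "cmod (LINT t|circle_measure. of_real (G (cis t)) * H t) \<le> (LINT t|circle_measure. \<bar>G (cis t)\<bar>)"
  proof (rule weak_contraction[OF \<alpha> H M G])
    fix \<rho> t :: real assume \<rho>: "0 \<le> \<rho>" "\<rho> < 1"
    let ?z = "of_real \<rho> * cis t"
    have z': "?z \<in> ball 0 1" using \<rho> by (simp add: norm_mult)
    have "f ?z = of_real (1 / (2 * pi)) * (LINT s|circle_measure. of_real (K_alpha \<alpha> (of_real \<rho> * cis (t - s))) * H s)"
      using harm[OF z'] P[OF z'] by (simp add: mult.assoc cis_mult)
    then have "cmod (LINT s|circle_measure. of_real (K_alpha \<alpha> (of_real \<rho> * cis (t - s))) * H s) = 2 * pi * cmod (f ?z)"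
      by (simp add: norm_mult norm_divide)
    then show "cmod (LINT s|circle_measure. of_real (K_alpha \<alpha> (of_real \<rho> * cis (t - s))) * H s) \<le> 2 * pi"
      using self[OF z'] by simp
  qed
  also have "\<dots> = 2 * pi * bound_rhs \<alpha> r"
    unfolding integral_abs_kernel_minus_median[OF \<alpha> r, of \<theta>, symmetric] Gcis[symmetric]
    by (intro integral_circle_measure_continuous continuous_intros Gc)
  finally show "cmod (f z) \<le> bound_rhs \<alpha> (cmod z)"
    unfolding fz norm_mult r_def by (simp add: field_simps norm_divide)
next
  fix r :: real assume "0 \<le> r \<and> r < 1"
  then show "bound_rhs 0 r = 4 / pi * arctan r" by (intro bound_rhs_0) auto
qed

end
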